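(* Let $S$ be a finite partially ordered set that is a linearly ordered spin space (i.e. $S$ belongs to the class $\mathcal{Z}$), let $d\ge1$ and $N\ge2$. Then: (1) for every $N$-tuple $(P^i)_{1\le i\le N}$ of PCA dynamics on $S^{\mathbb{Z}^d}$, there exists an increasing synchronous coupling of $(P^1,\dots,P^N)$ if and only if $(P^1,\dots,P^N)$ is increasing; (2) for every PCA dynamics $P$ on $S^{\mathbb{Z}^d}$, there exists an increasing synchronous coupling of the $N$-tuple $(P,\dots,P)$ if and only if $P$ is attractive.
   Context: Class $\mathcal{Z}$ (linearly ordered spaces): let $(S,\preceq)$ be a finite partially ordered set. A predecessor (resp. successor) of $s\in S$ is an element $s'\neq s$ of $S$ such that $s\preceq s'$ (resp. $s\succeq s'$) and $s\preceq s''\preceq s'\Rightarrow s''\in\{s,s'\}$ (resp. $s\succeq s''\succeq s'\Rightarrow s''\in\{s,s'\}$). $S$ belongs to $\mathcal{Z}$ if for every $s\in S$ exactly one of the following situations occurs: $s$ admits exactly one successor and exactly one predecessor; $s$ admits no predecessor and at most two successors; $s$ admits no successor and at most two predecessors. A PCA (probabilistic cellular automaton) dynamics on $S^{\mathbb{Z}^d}$ is a time-homogeneous discrete-time Markov chain on $S^{\mathbb{Z}^d}$ with transition kernel of product form $P(d\sigma\mid\eta)=\bigotimes_{k\in\mathbb{Z}^d}p_k(d\sigma_k\mid\eta)$, where $p_k(\cdot\mid\eta)$ is a probability measure on $S$; all PCA are assumed local: for every $k$ there is a finite $V_k\subset\mathbb{Z}^d$ such that $p_k(\cdot\mid\eta)$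 depends on $\eta$ only through $(\eta_j)_{j\in V_k}$. One writes $P^i=\bigotimes_kp^i_k$. Order: $\sigma\preceq\eta$ iff $\sigma_k\preceq\eta_k$ for all $k$. A real function $f$ is increasing if $\sigma\preceq\eta\Rightarrow f(\sigma)\le f(\eta)$. For probability measures, $\nu_1\preceq\nu_2$ means $\int f\,d\nu_1\le\int f\,d\nu_2$ for all increasing (bounded measurable) $f$. Attractive: $P$ is attractive if for every increasing (bounded measurable) $f$ on $S^{\mathbb{Z}^d}$, $P(f)(\eta)=\int f(\sigma)P(d\sigma\mid\eta)$ is increasing. Increasing $N$-tuple: $(P^1,\dots,P^N)$ is increasing if for all $\zeta^1\preceq\cdots\preceq\zeta^N$ in $S^{\mathbb{Z}^d}$, $P^1(\cdot\mid\zeta^1)\preceq\cdots\preceq P^N(\cdot\mid\zeta^N)$. Synchronous coupling of $(P^i)_{1\le i\le N}$: a Markovian dynamics $Q$ on $(S^{\mathbb{Z}^d})^N$ which is itself a (local) PCA dynamics (with spin space $S^N$), $Q=\bigotimes_{k}q_k$, such that for all $k$, $i$, $s^i\in S$ and $\zeta^1,\dots,\zeta^N\in S^{\mathbb{Z}^d}$, $p^i_k(s^i\mid\zeta^i)=\sum_{s^j\in S,\,j\ne i}q_k\big((s^1,\dots,s^N)\mid(\zeta^1,\dots,\zeta^N)\big)$. Increasing synchronous coupling: a synchronous coupling $Q$ such that for all initial configurations $\sigma^1\preceq\cdots\preceq\sigma^N$ and all times $n\ge1$, $Q\big(\omega^1(n)\preceq\cdots\preceq\omega^N(n)\mid(\omega^1,\dots,\omega^N)(0)=(\sigma^1,\dots,\sigma^N)\big)=1$.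 *)

theory Defs
  imports "HOL-Probability.Probability"
begin

section \<open>The class of linearly ordered spin spaces\<close>

text \<open>
  Note the orientation: a predecessor of \<open>s\<close> lies immediately above \<open>s\<close>, and a successor
  immediately below.
\<close>

definition predecessor :: "'s::order \<Rightarrow> 's \<Rightarrow> bool" where
  "predecessor s s' \<longleftrightarrow> s' \<noteq> s \<and> s \<le> s' \<and> (\<forall>s''. s \<le> s'' \<and> s'' \<le> s' \<longrightarrow> s'' \<in> {s, s'})"

definition successor :: "'s::order \<Rightarrow> 's \<Rightarrow> bool" where
  "successor s s' \<longleftrightarrow> s' \<noteq> s \<and> s \<ge> s' \<and> (\<forall>s''. s \<ge> s'' \<and> s'' \<ge> s' \<longrightarrow> s'' \<in> {s, s'})"

text \<open>
  ``Exactly one'' is taken literally: an element with neither predecessor nor successor satisfies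
  both the second and the third condition, and is therefore excluded.
\<close>

definition class_Z :: "'s::{finite,order} itself \<Rightarrow> bool" where
  "class_Z (_ :: 's itself) \<longleftrightarrow>
    (\<forall>s::'s.
      let A = (card {t. successor s t} = 1 \<and> card {t. predecessor s t} = 1);
          B = ({t. predecessor s t} = {} \<and> card {t. successor s t} \<le> 2);
          C = ({t. successor s t} = {} \<and> card {t. predecessor s t} \<le> 2)
      in (A \<and> \<not> B \<and> \<not> C) \<or> (\<not> A \<and> B \<and> \<not> C) \<or> (\<not> A \<and> \<not> B \<and> C))"


section \<open>PCA dynamics\<close>

text \<open>
  The lattice of dimension \<open>d\<close> is \<^typ>\<open>int ^ 'd\<close> with \<open>d = CARD('d)\<close>. The order on configurations
  is the library's pointwise order on functions.
\<close>

type_synonym ('d, 'a) config = "int ^ 'd \<Rightarrow> 'a"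

definition config_space :: "('d::finite, 'a::finite) config measure" where
  "config_space = (\<Pi>\<^sub>M k\<in>UNIV. count_space UNIV)"

text \<open>
  A PCA dynamics is given by its single-site kernels: \<open>p k \<eta>\<close> is the law of the next spin at \<open>k\<close>
  given the present configuration \<open>\<eta>\<close>.
\<close>

type_synonym ('d, 'a) rule = "int ^ 'd \<Rightarrow> ('d, 'a) config \<Rightarrow> 'a pmf"

definition PCA :: "('d::finite, 'a::finite) rule \<Rightarrow> bool" where
  "PCA p \<longleftrightarrow> (\<forall>k. \<exists>V. finite V \<and> (\<forall>\<eta> \<eta>'. (\<forall>j\<in>V. \<eta> j = \<eta>' j) \<longrightarrow> p k \<eta> = p k \<eta>'))"

definition kernel :: "('d::finite, 'a::finite) rule \<Rightarrow> ('d, 'a) config \<Rightarrow> ('d, 'a) config measure" where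
  "kernel p \<eta> = (\<Pi>\<^sub>M k\<in>UNIV. measure_pmf (p k \<eta>))"

text \<open>The law of \<open>\<omega>(n)\<close> given \<open>\<omega>(0) = \<sigma>\<close>, for the Markov chain with transition kernel \<open>K\<close>.\<close>

primrec law_at ::
  "(('d::finite, 'a::finite) config \<Rightarrow> ('d, 'a) config measure) \<Rightarrow> nat \<Rightarrow> ('d, 'a) config
    \<Rightarrow> ('d, 'a) config measure" where
  "law_at K 0 \<sigma> = return config_space \<sigma>"
| "law_at K (Suc n) \<sigma> = law_at K n \<sigma> \<bind> K"


section \<open>Monotonicity\<close>

definition stoch_le ::
  "('d::finite, 's::{finite,order}) config measure \<Rightarrow> ('d, 's) config measure \<Rightarrow> bool" where
  "stoch_le \<nu>\<^sub>1 \<nu>\<^sub>2 \<longleftrightarrow>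
    (\<forall>f :: ('d, 's) config \<Rightarrow> real.
      mono f \<and> bounded (range f) \<and> f \<in> borel_measurable config_space
      \<longrightarrow> (\<integral>\<sigma>. f \<sigma> \<partial>\<nu>\<^sub>1) \<le> (\<integral>\<sigma>. f \<sigma> \<partial>\<nu>\<^sub>2))"

definition attractive :: "('d::finite, 's::{finite,order}) rule \<Rightarrow> bool" where
  "attractive p \<longleftrightarrow>
    (\<forall>f :: ('d, 's) config \<Rightarrow> real.
      mono f \<and> bounded (range f) \<and> f \<in> borel_measurable config_space
      \<longrightarrow> mono (\<lambda>\<eta>. \<integral>\<sigma>. f \<sigma> \<partial>kernel p \<eta>))"

text \<open>
  \<open>N\<close>-tuples are functions on a finite linearly ordered index type \<open>'n\<close> with \<open>N = CARD('n)\<close>, so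
  that \<^term>\<open>mono \<zeta>\<close> says that the tuple of configurations \<open>\<zeta>\<close> is a chain.
\<close>

definition increasing_tuple ::
  "('n::{finite,linorder} \<Rightarrow> ('d::finite, 's::{finite,order}) rule) \<Rightarrow> bool" where
  "increasing_tuple p \<longleftrightarrow>
    (\<forall>\<zeta> :: 'n \<Rightarrow> ('d, 's) config. mono \<zeta> \<longrightarrow>
      (\<forall>i j. i \<le> j \<longrightarrow> stoch_le (kernel (p i) (\<zeta> i)) (kernel (p j) (\<zeta> j))))"


section \<open>Synchronous couplings\<close>

text \<open>
  The two directions of the identification of \<open>N\<close>-tuples of configurations with configurations
  of the spin space of \<open>N\<close>-tuples.
\<close>

definition join :: "('n \<Rightarrow> ('d, 's) config) \<Rightarrow> ('d, 'n \<Rightarrow> 's) config" where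
  "join \<zeta> = (\<lambda>k i. \<zeta> i k)"

definition split :: "('d, 'n \<Rightarrow> 's) config \<Rightarrow> 'n \<Rightarrow> ('d, 's) config" where
  "split \<omega> = (\<lambda>i k. \<omega> k i)"

definition synchronous_coupling ::
  "('n::{finite,linorder} \<Rightarrow> ('d::finite, 's::{finite,order}) rule) \<Rightarrow> ('d, 'n \<Rightarrow> 's) rule \<Rightarrow> bool"
where
  "synchronous_coupling p q \<longleftrightarrow> PCA q \<and>
    (\<forall>k i s \<zeta>. pmf (p i k (\<zeta> i)) s = (\<Sum>t | t i = s. pmf (q k (join \<zeta>)) t))"

definition increasing_synchronous_coupling ::
  "('n::{finite,linorder} \<Rightarrow> ('d::finite, 's::{finite,order}) rule) \<Rightarrow> ('d, 'n \<Rightarrow> 's) rule \<Rightarrow> bool"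
where
  "increasing_synchronous_coupling p q \<longleftrightarrow> synchronous_coupling p q \<and>
    (\<forall>\<sigma> :: 'n \<Rightarrow> ('d, 's) config. mono \<sigma> \<longrightarrow>
      (\<forall>n\<ge>1. \<P>(\<omega> in law_at (kernel q) n (join \<sigma>). mono (split \<omega>)) = 1))"

end

theory Submission
  imports Defs
begin

text \<open>
  Increasing functions of a single spin show that, along a chain of configurations, the single-site
  laws at each site are stochastically increasing. Strassen's theorem on the finite poset couples
  two consecutive laws monotonically, and gluing along the chain couples all \<open>N\<close> of them; using
  these couplings independently at each site preserves the order in one step, hence at all times.
  Conversely, integrating an increasing function against a coupling that preserves the order
  compares the marginals.
\<close>

section \<open>Finite transport plans under Hall's condition\<close>

definition nbrs :: "('a \<Rightarrow> 'b \<Rightarrow> bool) \<Rightarrow> 'b set \<Rightarrow> 'a set \<Rightarrow> 'b set" where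
  "nbrs R Y A = {y\<in>Y. \<exists>x\<in>A. R x y}"

text \<open>The weighted form of Hall's marriage condition: \<open>a\<close> gives the supplies and
  \<open>b\<close> the capacities. The finite vertex sets are kept explicit because the induction
  below deletes vertices.\<close>

definition Hall_condition ::
  "('a \<Rightarrow> 'b \<Rightarrow> bool) \<Rightarrow> 'a set \<Rightarrow> 'b set \<Rightarrow> ('a \<Rightarrow> real) \<Rightarrow> ('b \<Rightarrow> real) \<Rightarrow> bool" where
  "Hall_condition R X Y a b \<longleftrightarrow>
    (\<forall>x\<in>X. 0 \<le> a x) \<and> (\<forall>y\<in>Y. 0 \<le> b y) \<and> (\<forall>A\<subseteq>X. sum a A \<le> sum b (nbrs R Y A))"

text \<open>Supplies are shipped in full while capacities are only bounds, since Hall's condition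
  allows the total capacity to exceed the total supply, and so do the subproblems of the
  induction.\<close>

definition transport_plan ::
  "('a \<Rightarrow> 'b \<Rightarrow> bool) \<Rightarrow> 'a set \<Rightarrow> 'b set \<Rightarrow> ('a \<Rightarrow> real) \<Rightarrow> ('b \<Rightarrow> real) \<Rightarrow> ('a \<Rightarrow> 'b \<Rightarrow> real) \<Rightarrow> bool"
where
  "transport_plan R X Y a b w \<longleftrightarrow> (\<forall>x y. 0 \<le> w x y) \<and> (\<forall>x y. \<not> R x y \<longrightarrow> w x y = 0) \<and>
    (\<forall>x\<in>X. (\<Sum>y\<in>Y. w x y) = a x) \<and> (\<forall>y\<in>Y. (\<Sum>x\<in>X. w x y) \<le> b y)"

lemma finite_nbrs [simp]: "finite Y \<Longrightarrow> finite (nbrs R Y A)"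
  by (simp add: nbrs_def)

lemma nbrs_subset: "nbrs R Y A \<subseteq> Y"
  by (auto simp: nbrs_def)

lemma Hall_conditionD:
  assumes "Hall_condition R X Y a b"
  shows "x \<in> X \<Longrightarrow> 0 \<le> a x" "y \<in> Y \<Longrightarrow> 0 \<le> b y" "A \<subseteq> X \<Longrightarrow> sum a A \<le> sum b (nbrs R Y A)"
  using assms by (auto simp: Hall_condition_def)

lemma transport_planD:
  assumes "transport_plan R X Y a b w"
  shows "0 \<le> w x y" "\<not> R x y \<Longrightarrow> w x y = 0"
    "x \<in> X \<Longrightarrow> (\<Sum>y\<in>Y. w x y) = a x" "y \<in> Y \<Longrightarrow> (\<Sum>x\<in>X. w x y) \<le> b y"
  using assms by (auto simp: transport_plan_def)

text \<open>Used for the three reductions of the induction: dropping an exhausted source, dropping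
  an exhausted sink, and restricting to a tight set together with its neighbours.\<close>

lemma Hall_condition_mono:
  assumes "Hall_condition R X Y a b" "X' \<subseteq> X" "Y' \<subseteq> Y"
    and "\<And>A. A \<subseteq> X' \<Longrightarrow> sum b (nbrs R Y' A) = sum b (nbrs R Y A)"
  shows "Hall_condition R X' Y' a b"
  using assms unfolding Hall_condition_def by (metis subset_iff)

lemma transport_plan_insert_source:
  assumes "transport_plan R (X - {x}) Y a b w" "x \<in> X" "a x = 0" "finite X"
  shows "transport_plan R X Y a b (w(x := \<lambda>_. 0))"
proof -
  have "(\<Sum>z\<in>X. (w(x := \<lambda>_. 0)) z y) = (\<Sum>z\<in>X - {x}. w z y)" for y
    using assms(2,4) by (simp add: sum.remove)
  then show ?thesis using assms(1,3) by (auto simp: transport_plan_def)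
qed

lemma transport_plan_insert_sink:
  assumes "transport_plan R X (Y - {y}) a b w" "y \<in> Y" "b y = 0" "finite Y"
  shows "transport_plan R X Y a b (\<lambda>x. (w x)(y := 0))"
proof -
  have "(\<Sum>z\<in>Y. ((w x)(y := 0)) z) = (\<Sum>z\<in>Y - {y}. w x z)" for x
    using assms(2,4) by (simp add: sum.remove)
  moreover have "(\<Sum>x\<in>X. ((w x)(y := 0)) z) \<le> b z" if "z \<in> Y" for z
    using assms(1,3) that by (cases "z = y") (simp_all add: transport_plan_def)
  ultimately show ?thesis using assms(1) by (simp add: transport_plan_def)
qed

lemma transport_plan_glue:
  assumes u: "transport_plan R A B a b u" and v: "transport_plan R (X - A) (Y - B) a b v"
    and "A \<subseteq> X" "B \<subseteq> Y" "finite X" "finite Y"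
  shows "\<exists>w. transport_plan R X Y a b w"
proof -
  \<comment> \<open>Block-diagonal: no mass crosses between the two blocks, so every row and column
    is loaded by only one of the two plans.\<close>
  define w where "w x y = (if x \<in> A then if y \<in> B then u x y else 0
    else if y \<in> B then 0 else v x y)" for x y
  have row: "(\<Sum>y\<in>Y. w x y) = (\<Sum>y\<in>B. w x y) + (\<Sum>y\<in>Y - B. w x y)" for x
    using assms(4,6) by (subst add.commute, intro sum.subset_diff)
  have col: "(\<Sum>x\<in>X. w x y) = (\<Sum>x\<in>A. w x y) + (\<Sum>x\<in>X - A. w x y)" for y
    using assms(3,5) by (subst add.commute, intro sum.subset_diff)
  have "(\<Sum>y\<in>Y. w x y) = a x" if "x \<in> X" for x
    using that transport_planD(3)[OF u, of x] transport_planD(3)[OF v, of x]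
    unfolding row by (cases "x \<in> A") (simp_all add: w_def)
  moreover have "(\<Sum>x\<in>X. w x y) \<le> b y" if "y \<in> Y" for y
    using that transport_planD(4)[OF u, of y] transport_planD(4)[OF v, of y]
    unfolding col by (cases "y \<in> B") (simp_all add: w_def)
  ultimately have "transport_plan R X Y a b w"
    using transport_planD(1,2)[OF u] transport_planD(1,2)[OF v]
    by (auto simp: transport_plan_def w_def)
  then show ?thesis by blast
qed

text \<open>For \<open>B\<close> disjoint from the tight set \<open>A\<close>, Hall's inequality for
  \<open>A \<union> B\<close> minus the equality for \<open>A\<close> leaves the inequality for
  \<open>B\<close> with the neighbours of \<open>A\<close> removed.\<close>

lemma Hall_condition_diff_tight:
  assumes H: "Hall_condition R X Y a b" and A: "A \<subseteq> X" "sum a A = sum b (nbrs R Y A)"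
    and fin: "finite X" "finite Y"
  shows "Hall_condition R (X - A) (Y - nbrs R Y A) a b"
  unfolding Hall_condition_def
proof (intro conjI allI impI)
  fix B assume B: "B \<subseteq> X - A"
  have "finite A" "finite B" using A(1) B fin finite_subset by blast+
  then have "sum a A + sum a B = sum a (A \<union> B)"
    using B by (intro sum.union_disjoint[symmetric]) auto
  also have "\<dots> \<le> sum b (nbrs R Y (A \<union> B))"
    using A(1) B by (intro Hall_conditionD(3)[OF H]) auto
  also have "nbrs R Y (A \<union> B) = nbrs R Y A \<union> nbrs R (Y - nbrs R Y A) B"
    by (auto simp: nbrs_def)
  also have "sum b \<dots> = sum b (nbrs R Y A) + sum b (nbrs R (Y - nbrs R Y A) B)"
    using fin by (intro sum.union_disjoint) (auto simp: nbrs_def)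
  finally show "sum a B \<le> sum b (nbrs R (Y - nbrs R Y A) B)" using A(2) by simp
qed (use H in \<open>auto simp: Hall_condition_def\<close>)

lemma sum_fun_upd_diff:
  fixes f :: "'a \<Rightarrow> real"
  assumes "finite A"
  shows "sum (f(x := f x - \<epsilon>)) A = sum f A - (if x \<in> A then \<epsilon> else 0)"
proof -
  have "sum (f(x := f x - \<epsilon>)) A = (\<Sum>z\<in>A. f z - (if z = x then \<epsilon> else 0))"
    by (intro sum.cong) auto
  then show ?thesis using assms by (simp add: sum_subtractf)
qed

lemma transport_plan_add_edge:
  assumes w: "transport_plan R X Y (a(x := a x - \<epsilon>)) (b(y := b y - \<epsilon>)) w"
    and "x \<in> X" "y \<in> Y" "R x y" "0 \<le> \<epsilon>" "finite X" "finite Y"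
  shows "transport_plan R X Y a b (\<lambda>s t. w s t + (if s = x \<and> t = y then \<epsilon> else 0))"
proof -
  have delta: "(\<Sum>t\<in>Y. if s = x \<and> t = y then \<epsilon> else 0) = (if s = x then \<epsilon> else 0)"
    "(\<Sum>s\<in>X. if s = x \<and> t = y then \<epsilon> else 0) = (if t = y then \<epsilon> else 0)" for s t
    using assms(2,3,6,7) by auto
  show ?thesis
    unfolding transport_plan_def sum.distrib delta
  proof (intro conjI allI ballI impI)
    fix t assume "t \<in> Y"
    then show "(\<Sum>s\<in>X. w s t) + (if t = y then \<epsilon> else 0) \<le> b t"
      using transport_planD(4)[OF w, of t] by (auto split: if_splits)
  qed (use transport_planD(1-3)[OF w] assms(4,5) in auto)
qed

text \<open>A set containing \<open>x\<close> has \<open>y\<close> among its neighbours, so both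
  sides of its inequality drop by the same amount. Only sets that avoid \<open>x\<close> but have
  \<open>y\<close> as a neighbour lose slack. At the largest mass allowed by these slacks and by
  \<open>a x\<close> and \<open>b y\<close>, one constraint becomes an equality.\<close>

lemma saturating_edge:
  assumes H: "Hall_condition R X Y a b" and x: "x \<in> X" and y: "y \<in> Y" "R x y"
    and fin: "finite X" "finite Y"
  obtains \<epsilon> a' b' where "0 \<le> \<epsilon>" "a' = a(x := a x - \<epsilon>)" "b' = b(y := b y - \<epsilon>)"
    "Hall_condition R X Y a' b'"
    "(\<exists>x\<in>X. a' x = 0) \<or> (\<exists>y\<in>Y. b' y = 0) \<or>
      (\<exists>A\<subseteq>X. A \<noteq> {} \<and> A \<noteq> X \<and> sum a' A = sum b' (nbrs R Y A))"
proof -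
  let ?F = "{A. A \<subseteq> X - {x} \<and> y \<in> nbrs R Y A}"
  let ?slack = "\<lambda>A. sum b (nbrs R Y A) - sum a A"
  let ?E = "{a x, b y} \<union> ?slack ` ?F"
  \<comment> \<open>the largest mass that can be sent along the edge from \<open>x\<close> to \<open>y\<close>\<close>
  define \<epsilon> where "\<epsilon> = Min ?E"
  have finE: "finite ?E" using fin by simp
  have \<epsilon>_in: "\<epsilon> \<in> ?E"
    unfolding \<epsilon>_def using finE by (intro Min_in) auto
  have \<epsilon>_le: "\<And>e. e \<in> ?E \<Longrightarrow> \<epsilon> \<le> e"
    unfolding \<epsilon>_def using finE by (intro Min_le)
  have "0 \<le> e" if "e \<in> ?E" for e
    using that x y Hall_conditionD[OF H] by (fastforce simp: subset_Diff_insert)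
  then have \<epsilon>_nonneg: "0 \<le> \<epsilon>" using \<epsilon>_in .
  define a' where "a' = a(x := a x - \<epsilon>)"
  define b' where "b' = b(y := b y - \<epsilon>)"
  have sum_a': "sum a' A = sum a A - (if x \<in> A then \<epsilon> else 0)" if "A \<subseteq> X" for A
    unfolding a'_def using that fin(1) by (intro sum_fun_upd_diff) (rule finite_subset)
  have sum_b': "sum b' (nbrs R Y A) = sum b (nbrs R Y A) - (if y \<in> nbrs R Y A then \<epsilon> else 0)" for A
    unfolding b'_def using fin by (intro sum_fun_upd_diff) simp
  have "sum a' A \<le> sum b' (nbrs R Y A)" if A: "A \<subseteq> X" for A
  proof (cases "x \<in> A")
    case True
    then have "y \<in> nbrs R Y A" using y by (auto simp: nbrs_def)
    then show ?thesis
      using True Hall_conditionD(3)[OF H A] by (simp add: sum_a'[OF A] sum_b')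
  next
    case False
    show ?thesis
    proof (cases "y \<in> nbrs R Y A")
      case True
      then have "\<epsilon> \<le> ?slack A" using A False by (intro \<epsilon>_le) auto
      then show ?thesis using True False by (simp add: sum_a'[OF A] sum_b')
    next
      case 2: False
      then show ?thesis
        using False Hall_conditionD(3)[OF H A] by (simp add: sum_a'[OF A] sum_b')
    qed
  qed
  moreover have "0 \<le> a' s" if "s \<in> X" for s
    using that Hall_conditionD(1)[OF H] \<epsilon>_le[of "a x"] by (simp add: a'_def)
  moreover have "0 \<le> b' t" if "t \<in> Y" for t
    using that Hall_conditionD(2)[OF H] \<epsilon>_le[of "b y"] by (simp add: b'_def)
  ultimately have "Hall_condition R X Y a' b'" by (simp add: Hall_condition_def)
  moreover have "(\<exists>x\<in>X. a' x = 0) \<or> (\<exists>y\<in>Y. b' y = 0) \<or>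
    (\<exists>A\<subseteq>X. A \<noteq> {} \<and> A \<noteq> X \<and> sum a' A = sum b' (nbrs R Y A))"
  proof -
    consider "\<epsilon> = a x" | "\<epsilon> = b y" | A where "A \<in> ?F" "\<epsilon> = ?slack A"
      using \<epsilon>_in by blast
    then show ?thesis
    proof cases
      case 1
      then have "a' x = 0" by (simp add: a'_def)
      then show ?thesis using x by blast
    next
      case 2
      then have "b' y = 0" by (simp add: b'_def)
      then show ?thesis using y by blast
    next
      case 3
      then have A: "A \<subseteq> X" "x \<notin> A" "y \<in> nbrs R Y A" by auto
      \<comment> \<open>Both kinds of properness come from the choice of \<open>A\<close>: it has
        the neighbour \<open>y\<close>, and it misses \<open>x\<close>.\<close>
      then have "A \<noteq> {}" by (auto simp: nbrs_def)
      moreover have "sum a' A = sum b' (nbrs R Y A)"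
        using A 3(2) by (simp add: sum_a' sum_b')
      ultimately show ?thesis using A(1,2) x by blast
    qed
  qed
  ultimately show ?thesis using that \<epsilon>_nonneg a'_def b'_def by blast
qed

text \<open>
  The induction is the one that proves Hall's marriage theorem: mass is pushed along an edge until
  a source or a sink is exhausted, or a proper set of sources becomes tight and the problem splits.
\<close>

lemma transport_of_Hall:
  assumes "finite X" "finite Y" "Hall_condition R X Y a b"
  shows "\<exists>w. transport_plan R X Y a b w"
  using assms
proof (induction "card X + card Y" arbitrary: X Y a b rule: less_induct)
  case less
  note fin = \<open>finite X\<close> \<open>finite Y\<close> and H = \<open>Hall_condition R X Y a b\<close>
  have IH: "\<exists>w. transport_plan R X' Y' a b w"
    if "X' \<subseteq> X" "Y' \<subseteq> Y" "X' \<noteq> X \<or> Y' \<noteq> Y" "Hall_condition R X' Y' a b" for X' Y' a b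
  proof (rule less.hyps)
    have "card X' \<le> card X" "card Y' \<le> card Y"
      using that(1,2) fin by (simp_all add: card_mono)
    moreover have "card X' < card X \<or> card Y' < card Y"
      using that(1-3) fin by (metis psubset_card_mono psubsetI)
    ultimately show "card X' + card Y' < card X + card Y" by linarith
    show "finite X'" "finite Y'"
      using that(1,2) fin by (simp_all add: finite_subset)
    show "Hall_condition R X' Y' a b" by fact
  qed
  \<comment> \<open>Quantified over \<open>a\<close> and \<open>b\<close> because it serves both the
    given masses and those left after pushing mass along an edge.\<close>
  have reduce: "\<exists>w. transport_plan R X Y a b w"
    if H: "Hall_condition R X Y a b"
      and "(\<exists>x\<in>X. a x = 0) \<or> (\<exists>y\<in>Y. b y = 0) \<or>
        (\<exists>A\<subseteq>X. A \<noteq> {} \<and> A \<noteq> X \<and> sum a A = sum b (nbrs R Y A))" for a b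
    using that(2)
  proof (elim disjE bexE exE conjE)
    fix x assume x: "x \<in> X" "a x = 0"
    have "Hall_condition R (X - {x}) Y a b"
      using H by (rule Hall_condition_mono) auto
    then obtain w where "transport_plan R (X - {x}) Y a b w"
      using IH[of "X - {x}" Y] x by blast
    then show ?thesis using transport_plan_insert_source x fin by metis
  next
    fix y assume y: "y \<in> Y" "b y = 0"
    have "sum b (nbrs R (Y - {y}) A) = sum b (nbrs R Y A)" for A
      using y fin by (intro sum.mono_neutral_left) (auto simp: nbrs_def)
    then have "Hall_condition R X (Y - {y}) a b"
      by (intro Hall_condition_mono[OF H]) auto
    then obtain w where "transport_plan R X (Y - {y}) a b w"
      using IH[of X "Y - {y}"] y by blast
    then show ?thesis using transport_plan_insert_sink y fin by metis
  next
    \<comment> \<open>The tight block is a smaller problem because \<open>A \<noteq> X\<close>, the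
      complementary block because \<open>A \<noteq> {}\<close>.\<close>
    fix A assume A: "A \<subseteq> X" "A \<noteq> {}" "A \<noteq> X" "sum a A = sum b (nbrs R Y A)"
    have "nbrs R (nbrs R Y A) B = nbrs R Y B" if "B \<subseteq> A" for B
      using that by (auto simp: nbrs_def)
    then have "Hall_condition R A (nbrs R Y A) a b"
      using A(1) nbrs_subset[of R Y A] by (intro Hall_condition_mono[OF H]) auto
    then obtain u where "transport_plan R A (nbrs R Y A) a b u"
      using IH[of A "nbrs R Y A"] A nbrs_subset by metis
    moreover obtain v where "transport_plan R (X - A) (Y - nbrs R Y A) a b v"
      using IH[of "X - A" "Y - nbrs R Y A"] A Hall_condition_diff_tight[OF H A(1,4) fin] by blast
    ultimately show ?thesis
      using transport_plan_glue A(1) nbrs_subset fin by metis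
  qed
  show ?case
  proof (cases "X = {} \<or> (\<exists>x\<in>X. a x = 0)")
    case True
    then show ?thesis
    proof
      assume "X = {}"
      then have "transport_plan R X Y a b (\<lambda>_ _. 0)"
        using Hall_conditionD(2)[OF H] by (simp add: transport_plan_def)
      then show ?thesis by blast
    qed (use reduce[OF H] in blast)
  next
    case False
    then obtain x where x: "x \<in> X" "0 < a x"
      using Hall_conditionD(1)[OF H] by (metis all_not_in_conv less_eq_real_def)
    \<comment> \<open>Hall's inequality for a singleton of positive supply provides an edge to push
      along.\<close>
    have "a x \<le> sum b (nbrs R Y {x})" using Hall_conditionD(3)[OF H, of "{x}"] x(1) by simp
    then have "nbrs R Y {x} \<noteq> {}" using x(2) by auto
    then obtain y where y: "y \<in> Y" "R x y" by (auto simp: nbrs_def)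
    obtain \<epsilon> a' b' where \<epsilon>: "0 \<le> \<epsilon>" "a' = a(x := a x - \<epsilon>)" "b' = b(y := b y - \<epsilon>)"
      and "Hall_condition R X Y a' b'"
      and "(\<exists>x\<in>X. a' x = 0) \<or> (\<exists>y\<in>Y. b' y = 0) \<or>
        (\<exists>A\<subseteq>X. A \<noteq> {} \<and> A \<noteq> X \<and> sum a' A = sum b' (nbrs R Y A))"
      using saturating_edge[OF H x(1) y fin] by blast
    then obtain w where "transport_plan R X Y (a(x := a x - \<epsilon>)) (b(y := b y - \<epsilon>)) w"
      using reduce by blast
    then have "transport_plan R X Y a b (\<lambda>s t. w s t + (if s = x \<and> t = y then \<epsilon> else 0))"
      using x(1) y \<epsilon>(1) fin by (rule transport_plan_add_edge)
    then show ?thesis by blast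
  qed
qed

section \<open>Strassen's theorem and gluing along a chain\<close>

text \<open>The hypothesis is Hall's condition for the two mass functions. As both have total mass
  one, the transport plan fills every capacity and is the mass function of a coupling.\<close>

lemma Strassen_finite:
  fixes p :: "'a::finite pmf" and q :: "'b::finite pmf"
  assumes "\<And>A. measure_pmf.prob p A \<le> measure_pmf.prob q {y. \<exists>x\<in>A. R x y}"
  shows "rel_pmf R p q"
proof -
  have "sum (pmf p) A \<le> sum (pmf q) (nbrs R UNIV A)" for A
    using assms[of A] by (simp add: measure_measure_pmf_finite nbrs_def)
  then obtain w where "transport_plan R UNIV UNIV (pmf p) (pmf q) w"
    using transport_of_Hall[of UNIV UNIV R "pmf p" "pmf q"] by (auto simp: Hall_condition_def)
  then have nonneg: "\<And>x y. 0 \<le> w x y" and supp: "\<And>x y. \<not> R x y \<Longrightarrow> w x y = 0"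
    and row: "\<And>x. (\<Sum>y\<in>UNIV. w x y) = pmf p x" and col_le: "\<And>y. (\<Sum>x\<in>UNIV. w x y) \<le> pmf q y"
    by (simp_all add: transport_plan_def)
  have total: "(\<Sum>x\<in>UNIV. \<Sum>y\<in>UNIV. w x y) = 1"
    by (simp add: row sum_pmf_eq_1)
  have "(\<Sum>y\<in>UNIV. pmf q y - (\<Sum>x\<in>UNIV. w x y)) = 0"
    using total by (simp add: sum_subtractf sum_pmf_eq_1 sum.swap[of w])
  then have col: "(\<Sum>x\<in>UNIV. w x y) = pmf q y" for y
    using col_le by (subst (asm) sum_nonneg_eq_0_iff) auto
  have pmf_pq: "pmf (embed_pmf (case_prod w)) z = case_prod w z" for z
  proof (rule pmf_embed_pmf)
    show "(\<integral>\<^sup>+ z. ennreal (case_prod w z) \<partial>count_space UNIV) = 1"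
      using total nonneg
      by (simp add: nn_integral_count_space_finite sum_ennreal case_prod_beta sum.cartesian_product
          flip: UNIV_Times_UNIV)
  qed (use nonneg in auto)
  show ?thesis
  proof (rule rel_pmf.intros)
    show "R x y" if "(x, y) \<in> set_pmf (embed_pmf (case_prod w))" for x y
      using that supp[of x y] by (auto simp: set_pmf_iff pmf_pq)
    show "map_pmf fst (embed_pmf (case_prod w)) = p"
    proof (rule pmf_eqI)
      fix x :: 'a
      have "fst -` {x} = Pair x ` (UNIV :: 'b set)" by auto
      then show "pmf (map_pmf fst (embed_pmf (case_prod w))) x = pmf p x"
        by (simp add: pmf_map measure_measure_pmf_finite sum.reindex inj_on_def pmf_pq row)
    qed
    show "map_pmf snd (embed_pmf (case_prod w)) = q"
    proof (rule pmf_eqI)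
      fix y :: 'b
      have "snd -` {y} = (\<lambda>x. (x, y)) ` (UNIV :: 'a set)" by auto
      then show "pmf (map_pmf snd (embed_pmf (case_prod w))) y = pmf q y"
        by (simp add: pmf_map measure_measure_pmf_finite sum.reindex inj_on_def pmf_pq col)
    qed
  qed
qed

text \<open>Indices are added in increasing order. A new top spin need only dominate the spin at the
  largest earlier index; monotonicity of the earlier tuple and transitivity give the rest.\<close>

lemma monotone_coupling_exists:
  fixes \<mu> :: "'n::{finite,linorder} \<Rightarrow> 's::{finite,order} pmf"
  assumes le: "\<And>i j. i \<le> j \<Longrightarrow> rel_pmf (\<le>) (\<mu> i) (\<mu> j)"
  shows "\<exists>\<rho>. (\<forall>i. map_pmf (\<lambda>t. t i) \<rho> = \<mu> i) \<and> (\<forall>t\<in>set_pmf \<rho>. mono t)"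
proof -
  have "\<exists>\<rho>. (\<forall>i\<in>I. map_pmf (\<lambda>t. t i) \<rho> = \<mu> i) \<and> (\<forall>t\<in>set_pmf \<rho>. mono_on I t)"
    if "finite I" for I :: "'n set"
    using that
  proof (induction I rule: finite_linorder_max_induct)
    case empty
    then show ?case by (simp add: mono_on_def)
  next
    case (insert m I)
    then obtain \<rho> where \<rho>: "\<And>i. i \<in> I \<Longrightarrow> map_pmf (\<lambda>t. t i) \<rho> = \<mu> i"
      "\<And>t. t \<in> set_pmf \<rho> \<Longrightarrow> mono_on I t" by blast
    have "rel_pmf (\<lambda>t y. \<forall>i\<in>I. t i \<le> y) \<rho> (\<mu> m)"
    proof (cases "I = {}")
      case True
      then show ?thesis by (intro rel_pmf.intros[of "pair_pmf \<rho> (\<mu> m)"])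
          (auto simp: map_fst_pair_pmf map_snd_pair_pmf)
    next
      case False
      define l where "l = Max I"
      have l: "l \<in> I" "\<And>i. i \<in> I \<Longrightarrow> i \<le> l" using False insert.hyps by (auto simp: l_def)
      have "rel_pmf (\<le>) (map_pmf (\<lambda>t. t l) \<rho>) (\<mu> m)"
        using le[of l m] l(1) insert.hyps by (auto simp: \<rho>(1))
      \<comment> \<open>The gluing: \<open>pmf.rel_map\<close> turns a coupling of the marginal at
        \<open>l\<close> with \<open>\<mu> m\<close> into a coupling of the whole tuple law with
        \<open>\<mu> m\<close>.\<close>
      then have "rel_pmf (\<lambda>t y. t l \<le> y) \<rho> (\<mu> m)" by (simp add: pmf.rel_map)
      then show ?thesis
        by (rule pmf.rel_mono_strong) (use \<rho>(2) l in \<open>blast intro: mono_onD order_trans\<close>)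
    qed
    then obtain pq where pq: "\<And>t y. (t, y) \<in> set_pmf pq \<Longrightarrow> \<forall>i\<in>I. t i \<le> y"
      "map_pmf fst pq = \<rho>" "map_pmf snd pq = \<mu> m"
      by (auto elim: rel_pmf.cases)
    let ?\<rho> = "map_pmf (\<lambda>(t, y). t(m := y)) pq"
    have "map_pmf (\<lambda>t. t i) ?\<rho> = \<mu> i" if "i \<in> insert m I" for i
    proof (cases "i = m")
      case True
      then have "map_pmf (\<lambda>t. t i) ?\<rho> = map_pmf snd pq"
        unfolding pmf.map_comp by (intro map_pmf_cong) auto
      then show ?thesis using True pq by simp
    next
      case False
      then have "map_pmf (\<lambda>t. t i) ?\<rho> = map_pmf (\<lambda>t. t i) (map_pmf fst pq)"
        unfolding pmf.map_comp by (intro map_pmf_cong) auto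
      then show ?thesis using False that pq \<rho>(1) by simp
    qed
    moreover have "mono_on (insert m I) t" if t: "t \<in> set_pmf ?\<rho>" for t
    proof -
      obtain t' y where t': "(t', y) \<in> set_pmf pq" "t = t'(m := y)" using t by auto
      have "t' \<in> set_pmf \<rho>" using t' pq(2) by (force simp flip: pq(2))
      then have "mono_on I t'" by (rule \<rho>(2))
      then show ?thesis using t' pq(1)[OF t'(1)] insert.hyps
        by (auto simp: mono_on_def)
    qed
    ultimately show ?case by blast
  qed
  from this[of UNIV] show ?thesis by auto
qed

section \<open>Measurability and product kernels\<close>

lemma space_config_space [simp]: "space config_space = UNIV"
  by (simp add: config_space_def space_PiM)

lemma sets_kernel_eq [simp, measurable_cong]: "sets (kernel p \<eta>) = sets config_space"
  unfolding kernel_def config_space_def by (intro sets_PiM_cong) auto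

lemma space_kernel [simp]: "space (kernel p \<eta>) = UNIV"
  using sets_eq_imp_space_eq[OF sets_kernel_eq] by simp

lemma prob_space_kernel [simp]: "prob_space (kernel p \<eta>)"
  unfolding kernel_def by (intro prob_space_PiM measure_pmf.prob_space_axioms)

lemma measurable_spin [measurable]:
  "(\<lambda>\<eta>. \<eta> k) \<in> measurable config_space (count_space UNIV)"
  unfolding config_space_def by simp

lemma emeasure_kernel_cylinder:
  assumes "finite J"
  shows "emeasure (kernel p \<eta>) {\<omega>. \<forall>k\<in>J. \<omega> k \<in> E k} = (\<Prod>k\<in>J. emeasure (p k \<eta>) (E k))"
proof -
  interpret product_prob_space "\<lambda>k. measure_pmf (p k \<eta>)" UNIV
    by unfold_locales
  show ?thesis
    using emeasure_PiM_Collect[of J E] assms by (simp add: kernel_def space_PiM)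
qed

text \<open>The function factors through the restriction to \<open>V\<close>, which takes values in
  a finite discrete product.\<close>

lemma measurable_local:
  fixes g :: "('d::finite, 'a::finite) config \<Rightarrow> 'b"
  assumes "finite V" and local: "\<And>\<eta> \<eta>'. (\<forall>j\<in>V. \<eta> j = \<eta>' j) \<Longrightarrow> g \<eta> = g \<eta>'"
  shows "g \<in> measurable config_space (count_space UNIV)"
proof -
  have "(\<lambda>\<eta>. restrict \<eta> V) \<in> measurable config_space (Pi\<^sub>M V (\<lambda>_. count_space UNIV))"
    unfolding config_space_def by (intro measurable_restrict) simp
  also have "Pi\<^sub>M V (\<lambda>_. count_space UNIV) = count_space (V \<rightarrow>\<^sub>E (UNIV :: 'a set))"
    using \<open>finite V\<close> by (intro count_space_PiM_finite) auto
  finally have "g \<circ> (\<lambda>\<eta>. restrict \<eta> V) \<in> measurable config_space (count_space UNIV)"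
    by (rule measurable_comp) simp
  moreover have "g \<circ> (\<lambda>\<eta>. restrict \<eta> V) = g"
    using local by (auto simp: fun_eq_iff)
  ultimately show ?thesis by simp
qed

text \<open>Cylinders form an intersection-stable generator, and the probability of a cylinder is a
  finite product of local functions of the present configuration. This makes the \<open>bind\<close>
  in \<open>law_at\<close> meaningful.\<close>

lemma measurable_kernel:
  assumes "PCA p"
  shows "kernel p \<in> measurable config_space (prob_algebra config_space)"
proof (rule measurable_prob_algebra_generated)
  let ?G = "prod_algebra (UNIV :: (int ^ 'a) set) (\<lambda>_. count_space (UNIV :: 'b set))"
  show "sets config_space = sigma_sets UNIV ?G"
    unfolding config_space_def sets_PiM by simp
  show "Int_stable ?G" by (rule Int_stable_prod_algebra)
  fix A assume "A \<in> ?G"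
  then obtain J E where "A = prod_emb UNIV (\<lambda>_. count_space UNIV) J (Pi\<^sub>E J E)" and "finite J"
    by (rule prod_algebraE)
  then have A: "A = {\<omega>. \<forall>k\<in>J. \<omega> k \<in> E k}"
    by (auto simp: prod_emb_def PiE_iff)
  have "(\<lambda>\<eta>. \<Prod>k\<in>J. emeasure (p k \<eta>) (E k)) \<in> borel_measurable config_space"
  proof (intro borel_measurable_prod_ennreal)
    fix k
    obtain V where "finite V" "\<And>\<eta> \<eta>'. \<forall>j\<in>V. \<eta> j = \<eta>' j \<Longrightarrow> p k \<eta> = p k \<eta>'"
      using assms unfolding PCA_def by metis
    then have "p k \<in> measurable config_space (count_space UNIV)"
      by (rule measurable_local)
    then show "(\<lambda>\<eta>. emeasure (p k \<eta>) (E k)) \<in> borel_measurable config_space"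
      by (rule measurable_compose) simp
  qed
  then show "(\<lambda>\<eta>. emeasure (kernel p \<eta>) A) \<in> borel_measurable config_space"
    using \<open>finite J\<close> by (simp add: A emeasure_kernel_cylinder)
qed auto

lemma distr_kernel_component:
  "distr (kernel p \<eta>) (count_space UNIV) (\<lambda>\<omega>. \<omega> k) = measure_pmf (p k \<eta>)"
proof -
  have "distr (kernel p \<eta>) (p k \<eta>) (\<lambda>\<omega>. \<omega> k) = measure_pmf (p k \<eta>)"
    unfolding kernel_def by (rule distr_PiM_component) (auto intro: measure_pmf.prob_space_axioms)
  moreover have "distr (kernel p \<eta>) (count_space UNIV) (\<lambda>\<omega>. \<omega> k) = distr (kernel p \<eta>) (p k \<eta>) (\<lambda>\<omega>. \<omega> k)"
    by (rule distr_cong) simp_all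
  ultimately show ?thesis by simp
qed

text \<open>The lattice is countable, so the exceptional null sets of the single sites have a null
  union.\<close>

lemma AE_kernel_component: "AE \<omega> in kernel p \<eta>. \<forall>k. \<omega> k \<in> set_pmf (p k \<eta>)"
proof -
  interpret product_prob_space "\<lambda>k. measure_pmf (p k \<eta>)" UNIV
    by unfold_locales
  show ?thesis
    unfolding kernel_def AE_all_countable by (intro allI AE_component) (auto simp: AE_measure_pmf)
qed

section \<open>From stochastic order of kernels to order at each site\<close>

text \<open>The indicator of an up-set, evaluated at site \<open>k\<close>, is an admissible
  increasing test function.\<close>

lemma stoch_le_component:
  assumes le: "stoch_le (kernel p \<eta>) (kernel p' \<eta>')"
    and U: "\<And>x y. x \<in> U \<Longrightarrow> x \<le> y \<Longrightarrow> y \<in> U"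
  shows "measure_pmf.prob (p k \<eta>) U \<le> measure_pmf.prob (p' k \<eta>') U"
proof -
  let ?f = "\<lambda>\<omega>. indicator U (\<omega> k) :: real"
  have [measurable]: "?f \<in> borel_measurable config_space" by measurable
  have "mono ?f"
    using U by (auto simp: mono_def le_fun_def indicator_def)
  moreover have "bounded (range ?f)"
    by (rule boundedI[of _ 1]) (auto simp: indicator_def)
  ultimately have "(\<integral>\<omega>. ?f \<omega> \<partial>kernel p \<eta>) \<le> (\<integral>\<omega>. ?f \<omega> \<partial>kernel p' \<eta>')"
    using le by (simp add: stoch_le_def)
  moreover have "(\<integral>\<omega>. ?f \<omega> \<partial>kernel p \<eta>) = measure_pmf.prob (p k \<eta>) U" for p \<eta>
  proof -
    have "(\<integral>\<omega>. ?f \<omega> \<partial>kernel p \<eta>)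
        = (\<integral>s. indicator U s \<partial>distr (kernel p \<eta>) (count_space UNIV) (\<lambda>\<omega>. \<omega> k))"
      by (intro integral_distr[symmetric]) simp_all
    then show ?thesis by (simp add: distr_kernel_component)
  qed
  ultimately show ?thesis by simp
qed

lemma rel_pmf_of_stoch_le:
  fixes p p' :: "('d::finite, 's::{finite,order}) rule"
  assumes "stoch_le (kernel p \<eta>) (kernel p' \<eta>')"
  shows "rel_pmf (\<le>) (p k \<eta>) (p' k \<eta>')"
proof (rule Strassen_finite)
  fix A :: "'s set"
  \<comment> \<open>The up-closure of \<open>A\<close> is both an up-set containing \<open>A\<close>
    and the neighbourhood of \<open>A\<close> in Strassen's condition.\<close>
  let ?U = "{y. \<exists>x\<in>A. x \<le> y}"
  have "measure_pmf.prob (p k \<eta>) A \<le> measure_pmf.prob (p k \<eta>) ?U"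
    by (intro measure_pmf.finite_measure_mono) auto
  also have "\<dots> \<le> measure_pmf.prob (p' k \<eta>') ?U"
    by (rule stoch_le_component[OF assms]) (auto intro: order_trans)
  finally show "measure_pmf.prob (p k \<eta>) A \<le> measure_pmf.prob (p' k \<eta>') ?U" .
qed

section \<open>Tuples of configurations and marginals of couplings\<close>

lemma join_split [simp]: "join (split \<omega>) = \<omega>" and split_join [simp]: "split (join \<zeta>) = \<zeta>"
  by (simp_all add: join_def split_def)

lemma mono_split_iff: "mono (split \<omega>) \<longleftrightarrow> (\<forall>k. mono (\<omega> k))"
  by (auto simp: mono_def split_def le_fun_def)

text \<open>The event is a countable intersection over sites of conditions on one finite
  spin.\<close>

lemma pred_mono_split [measurable]:
  "Measurable.pred config_space (\<lambda>\<omega> :: ('d::finite, 'n::{finite,order} \<Rightarrow> 's::{finite,order}) config. mono (split \<omega>))"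
  unfolding mono_split_iff
  by (intro pred_intros_countable(1) measurable_compose[OF measurable_spin]) simp

lemma synchronous_coupling_iff:
  fixes p :: "'n::{finite,linorder} \<Rightarrow> ('d::finite, 's::{finite,order}) rule"
  shows "synchronous_coupling p q \<longleftrightarrow>
    PCA q \<and> (\<forall>k i \<zeta>. map_pmf (\<lambda>t. t i) (q k (join \<zeta>)) = p i k (\<zeta> i))"
proof -
  have "(\<Sum>t | t i = s. pmf \<rho> t) = pmf (map_pmf (\<lambda>t. t i) \<rho>) s" for \<rho> :: "('n \<Rightarrow> 's) pmf" and i s
    by (simp add: pmf_map vimage_def measure_measure_pmf_finite[OF finite])
  then show ?thesis
    unfolding synchronous_coupling_def by (metis pmf_eqI)
qed

lemma measurable_split [measurable]:
  fixes i :: "'n::finite"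
  shows "(\<lambda>\<omega> :: ('d::finite, 'n \<Rightarrow> 'a::finite) config. split \<omega> i) \<in> measurable config_space config_space"
proof -
  have "(\<lambda>\<omega> :: ('d, 'n \<Rightarrow> 'a) config. split \<omega> i) \<in>
      measurable config_space (\<Pi>\<^sub>M k\<in>UNIV. count_space UNIV)"
  proof (rule measurable_PiM_single')
    show "(\<lambda>\<omega> :: ('d, 'n \<Rightarrow> 'a) config. split \<omega> i k) \<in>
        measurable config_space (count_space UNIV)" for k
      unfolding split_def by (rule measurable_compose[OF measurable_spin]) simp
  qed auto
  then show ?thesis by (simp add: config_space_def)
qed

text \<open>Site by site the marginal is right, and a marginal of a product over sites is the
  product of the marginals; agreement on cylinders identifies the measure.\<close>

lemma distr_coupling:
  assumes "synchronous_coupling p q"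
  shows "distr (kernel q (join \<zeta>)) config_space (\<lambda>\<omega>. split \<omega> i) = kernel (p i) (\<zeta> i)"
proof -
  interpret product_prob_space "\<lambda>k. measure_pmf (p i k (\<zeta> i))" UNIV
    by unfold_locales
  have meas: "(\<lambda>\<omega>. split \<omega> i) \<in> measurable (kernel q (join \<zeta>)) config_space"
    by measurable
  show ?thesis
    unfolding kernel_def[of "p i"]
  proof (rule PiM_eq)
    show "sets (distr (kernel q (join \<zeta>)) config_space (\<lambda>\<omega>. split \<omega> i))
        = sets (\<Pi>\<^sub>M k\<in>UNIV. measure_pmf (p i k (\<zeta> i)))"
      using sets_kernel_eq[of "p i" "\<zeta> i"] by (simp add: kernel_def)
    fix J :: "(int ^ 'b) set" and F :: "int ^ 'b \<Rightarrow> 'c set"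
    assume J: "finite J"
    let ?C = "prod_emb UNIV (\<lambda>k. measure_pmf (p i k (\<zeta> i))) J (Pi\<^sub>E J F)"
    have C: "?C = {\<sigma>. \<forall>k\<in>J. \<sigma> k \<in> F k}"
      by (auto simp: prod_emb_def PiE_iff)
    have "?C \<in> sets (kernel (p i) (\<zeta> i))"
      unfolding kernel_def using J by (intro sets_PiM_I) auto
    then have "emeasure (distr (kernel q (join \<zeta>)) config_space (\<lambda>\<omega>. split \<omega> i)) ?C
        = emeasure (kernel q (join \<zeta>)) {\<omega>. \<forall>k\<in>J. \<omega> k \<in> (\<lambda>t. t i) -` F k}"
      by (subst emeasure_distr[OF meas]) (auto simp: C split_def intro!: arg_cong2[where f = emeasure])
    also have "\<dots> = (\<Prod>k\<in>J. emeasure (p i k (\<zeta> i)) (F k))"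
      using assms J by (subst emeasure_kernel_cylinder)
        (auto simp: synchronous_coupling_iff simp flip: emeasure_map_pmf)
    finally show "emeasure (distr (kernel q (join \<zeta>)) config_space (\<lambda>\<omega>. split \<omega> i)) ?C
        = (\<Prod>k\<in>J. emeasure (p i k (\<zeta> i)) (F k))" .
  qed
qed

section \<open>Preservation of order along the chain\<close>

lemma law_at_prob_algebra:
  assumes "PCA q"
  shows "law_at (kernel q) n \<sigma> \<in> space (prob_algebra config_space)"
proof (induction n)
  case 0
  then show ?case by (simp add: space_prob_algebra prob_space_return)
next
  case (Suc n)
  then show ?case
    using prob_space_bind'[OF Suc measurable_kernel[OF assms]] sets_bind'[OF Suc measurable_kernel[OF assms]]
    by (simp add: space_prob_algebra)
qed

lemma prob_mono_split_eq_1_iff: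
  assumes "PCA q"
  shows "\<P>(\<omega> in law_at (kernel q) n \<sigma>. mono (split \<omega>)) = 1 \<longleftrightarrow>
    (AE \<omega> in law_at (kernel q) n \<sigma>. mono (split \<omega>))"
proof -
  have law: "prob_space (law_at (kernel q) n \<sigma>)" "sets (law_at (kernel q) n \<sigma>) = sets config_space"
    using law_at_prob_algebra[OF assms] by (simp_all add: space_prob_algebra)
  have "Measurable.pred (law_at (kernel q) n \<sigma>) (\<lambda>\<omega>. mono (split \<omega>))"
    using pred_mono_split unfolding measurable_cong_sets[OF law(2) refl] .
  then show ?thesis
    by (intro prob_space.prob_Collect_eq_1[OF law(1)] predE)
qed

lemma AE_law_at_mono:
  assumes "PCA q" and "mono \<sigma>"
    and step: "\<And>\<zeta>. mono \<zeta> \<Longrightarrow> AE \<omega> in kernel q (join \<zeta>). mono (split \<omega>)"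
  shows "AE \<omega> in law_at (kernel q) n (join \<sigma>). mono (split \<omega>)"
proof (induction n)
  case 0
  have "AE \<omega> in return config_space (join \<sigma>). mono (split \<omega>)"
    by (subst AE_return) (use \<open>mono \<sigma>\<close> in simp_all)
  then show ?case unfolding law_at.simps .
next
  case (Suc n)
  let ?L = "law_at (kernel q) n (join \<sigma>)"
  have "sets ?L = sets config_space"
    using law_at_prob_algebra[OF assms(1)] by (simp add: space_prob_algebra)
  then have "kernel q \<in> measurable ?L (subprob_algebra config_space)"
    using measurable_prob_algebraD[OF measurable_kernel[OF assms(1)]] by (simp cong: measurable_cong_sets)
  moreover have "AE \<eta> in ?L. AE \<omega> in kernel q \<eta>. mono (split \<omega>)"
    \<comment> \<open>The one-step hypothesis speaks of joined tuples, and every configuration is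
      the \<open>join\<close> of its \<open>split\<close>.\<close>
    using Suc by eventually_elim (use step in \<open>metis join_split\<close>)
  ultimately show ?case
    unfolding law_at.simps by (subst AE_bind[OF _ pred_mono_split])
qed

section \<open>The two implications and the attractive case\<close>

text \<open>Time one suffices: an increasing function of the components is almost surely ordered,
  and by \<open>distr_coupling\<close> its integrals are those against the individual
  kernels.\<close>

lemma increasing_tuple_of_coupling:
  assumes inc: "increasing_synchronous_coupling p q"
  shows "increasing_tuple p"
  unfolding increasing_tuple_def stoch_le_def
proof (intro allI impI; elim conjE)
  fix \<zeta> :: "'a \<Rightarrow> ('b, 'c) config" and i j :: 'a and f :: "('b, 'c) config \<Rightarrow> real"
  assume \<zeta>: "mono \<zeta>" and "i \<le> j"
    and f: "mono f" "bounded (range f)" and [measurable]: "f \<in> borel_measurable config_space"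
  have sync: "synchronous_coupling p q" and "PCA q"
    using inc by (simp_all add: increasing_synchronous_coupling_def synchronous_coupling_def)
  let ?K = "kernel q (join \<zeta>)"
  have "law_at (kernel q) 1 (join \<zeta>) = ?K"
    using measurable_prob_algebraD[OF measurable_kernel[OF \<open>PCA q\<close>]] by (simp add: bind_return)
  moreover have "\<P>(\<omega> in law_at (kernel q) 1 (join \<zeta>). mono (split \<omega>)) = 1"
    using inc \<zeta> unfolding increasing_synchronous_coupling_def by blast
  ultimately have mono: "AE \<omega> in ?K. mono (split \<omega>)"
    using prob_mono_split_eq_1_iff[OF \<open>PCA q\<close>, of 1 "join \<zeta>"] by metis
  interpret prob_space ?K by simp
  obtain B where B: "\<And>\<sigma>. norm (f \<sigma>) \<le> B"
    using f(2) by (auto simp: bounded_iff)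
  have "integrable ?K (\<lambda>\<omega>. f (split \<omega> l))" for l
    by (rule integrable_const_bound[of _ B]) (use B in auto)
  then have "(\<integral>\<omega>. f (split \<omega> i) \<partial>?K) \<le> (\<integral>\<omega>. f (split \<omega> j) \<partial>?K)"
    using mono by (intro integral_mono_AE) (auto elim!: eventually_mono intro: monoD[OF f(1)] monoD \<open>i \<le> j\<close>)
  moreover have "(\<integral>\<sigma>. f \<sigma> \<partial>kernel (p l) (\<zeta> l)) = (\<integral>\<omega>. f (split \<omega> l) \<partial>?K)" for l
    by (subst distr_coupling[OF sync, symmetric]) (simp add: integral_distr)
  ultimately show "(\<integral>\<sigma>. f \<sigma> \<partial>kernel (p i) (\<zeta> i)) \<le> (\<integral>\<sigma>. f \<sigma> \<partial>kernel (p j) (\<zeta> j))" by simp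
qed

text \<open>
  The single-site coupling is chosen as a function of the tuple of marginal laws alone, so that
  the coupled rule inherits locality.
\<close>

definition monotone_coupling :: "('n::{finite,linorder} \<Rightarrow> 's::{finite,order} pmf) \<Rightarrow> ('n \<Rightarrow> 's) pmf" where
  "monotone_coupling \<mu> = (SOME \<rho>. (\<forall>i. map_pmf (\<lambda>t. t i) \<rho> = \<mu> i) \<and>
    ((\<forall>i j. i \<le> j \<longrightarrow> rel_pmf (\<le>) (\<mu> i) (\<mu> j)) \<longrightarrow> (\<forall>t\<in>set_pmf \<rho>. mono t)))"

text \<open>A synchronous coupling prescribes the marginals for all tuples of configurations, not
  only for chains, so the marginal property is unconditional and only monotonicity depends on the
  order of the laws.\<close>

lemma monotone_coupling:
  shows map_monotone_coupling: "map_pmf (\<lambda>t. t i) (monotone_coupling \<mu>) = \<mu> i"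
    and mono_monotone_coupling:
      "(\<And>i j. i \<le> j \<Longrightarrow> rel_pmf (\<le>) (\<mu> i) (\<mu> j)) \<Longrightarrow> t \<in> set_pmf (monotone_coupling \<mu>) \<Longrightarrow> mono t"
proof -
  have "\<exists>\<rho>. (\<forall>i. map_pmf (\<lambda>t. t i) \<rho> = \<mu> i) \<and>
    ((\<forall>i j. i \<le> j \<longrightarrow> rel_pmf (\<le>) (\<mu> i) (\<mu> j)) \<longrightarrow> (\<forall>t\<in>set_pmf \<rho>. mono t))"
  proof (cases "\<forall>i j. i \<le> j \<longrightarrow> rel_pmf (\<le>) (\<mu> i) (\<mu> j)")
    case True
    then show ?thesis using monotone_coupling_exists[of \<mu>] by blast
  next
    case False
    then show ?thesis
      \<comment> \<open>For unordered laws the independent coupling serves; the default value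
        \<open>undefined\<close> is never taken because the index set is
        \<open>UNIV\<close>.\<close>
      by (intro exI[of _ "Pi_pmf UNIV undefined \<mu>"] conjI) (simp add: Pi_pmf_component, blast)
  qed
  from someI_ex[OF this, folded monotone_coupling_def]
  show "map_pmf (\<lambda>t. t i) (monotone_coupling \<mu>) = \<mu> i"
    and "(\<And>i j. i \<le> j \<Longrightarrow> rel_pmf (\<le>) (\<mu> i) (\<mu> j)) \<Longrightarrow> t \<in> set_pmf (monotone_coupling \<mu>) \<Longrightarrow> mono t"
    by blast+
qed

lemma coupling_of_increasing_tuple:
  assumes PCA: "\<And>i. PCA (p i)" and inc: "increasing_tuple p"
  shows "\<exists>q. increasing_synchronous_coupling p q"
proof -
  define q where "q k \<omega> = monotone_coupling (\<lambda>i. p i k (split \<omega> i))" for k \<omega>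
  have "PCA q"
    unfolding PCA_def
  proof
    fix k
    have "\<forall>i. \<exists>V. finite V \<and> (\<forall>\<eta> \<eta>'. (\<forall>j\<in>V. \<eta> j = \<eta>' j) \<longrightarrow> p i k \<eta> = p i k \<eta>')"
      using PCA unfolding PCA_def by blast
    from choice[OF this] obtain V where V: "\<And>i. finite (V i)"
      "\<And>i \<eta> \<eta>'. \<forall>j\<in>V i. \<eta> j = \<eta>' j \<Longrightarrow> p i k \<eta> = p i k \<eta>'"
      by blast
    \<comment> \<open>The coupled rule reads the union of the neighbourhoods of all components,
      which is finite because the index type is.\<close>
    have "q k \<omega> = q k \<omega>'" if "\<forall>j\<in>\<Union>i. V i. \<omega> j = \<omega>' j" for \<omega> \<omega>'
    proof -
      have "p i k (split \<omega> i) = p i k (split \<omega>' i)" for i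
        using that by (intro V(2)) (auto simp: split_def)
      then show ?thesis by (simp add: q_def)
    qed
    then show "\<exists>V. finite V \<and> (\<forall>\<omega> \<omega>'. (\<forall>j\<in>V. \<omega> j = \<omega>' j) \<longrightarrow> q k \<omega> = q k \<omega>')"
      using V(1) by (intro exI[of _ "\<Union>i. V i"]) auto
  qed
  then have "synchronous_coupling p q"
    by (simp add: synchronous_coupling_iff q_def map_monotone_coupling)
  \<comment> \<open>Almost surely every site carries a tuple from the support of its coupling, and
    along a chain the laws at each site are ordered, so this tuple is monotone.\<close>
  moreover have step: "AE \<omega> in kernel q (join \<zeta>). mono (split \<omega>)" if \<zeta>: "mono \<zeta>" for \<zeta>
    using AE_kernel_component
  proof eventually_elim
    case (elim \<omega>)
    have "rel_pmf (\<le>) (p i k (\<zeta> i)) (p j k (\<zeta> j))" if "i \<le> j" for i j k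
      using inc \<zeta> that by (intro rel_pmf_of_stoch_le) (simp add: increasing_tuple_def)
    then show ?case
      using elim mono_monotone_coupling by (fastforce simp: mono_split_iff q_def)
  qed
  ultimately have "increasing_synchronous_coupling p q"
    using AE_law_at_mono[OF \<open>PCA q\<close> _ step]
    by (simp add: increasing_synchronous_coupling_def prob_mono_split_eq_1_iff[OF \<open>PCA q\<close>])
  then show ?thesis by blast
qed

lemma increasing_tuple_const_iff:
  assumes "CARD('n::{finite,linorder}) \<ge> 2"
  shows "increasing_tuple (\<lambda>_::'n. p) \<longleftrightarrow> attractive p"
proof
  assume "attractive p"
  then show "increasing_tuple (\<lambda>_::'n. p)"
    by (auto simp: attractive_def increasing_tuple_def stoch_le_def dest: monoD)
next
  assume inc: "increasing_tuple (\<lambda>_::'n. p)"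
  have "\<not> card (UNIV :: 'n set) \<le> Suc 0" using assms by simp
  then obtain i j :: 'n where "i < j"
    by (metis card_le_Suc0_iff_eq finite linorder_neqE UNIV_I)
  have "stoch_le (kernel p \<eta>) (kernel p \<eta>')" if "\<eta> \<le> \<eta>'" for \<eta> \<eta>'
  proof -
    \<comment> \<open>A chain that jumps from \<open>\<eta>\<close> to \<open>\<eta>'\<close> right
      after \<open>i\<close>; comparing its entries at \<open>i\<close> and \<open>j\<close>
      compares the two kernels.\<close>
    have "mono (\<lambda>l. if l \<le> i then \<eta> else \<eta>')"
      using that by (auto simp: mono_def)
    from inc[unfolded increasing_tuple_def, rule_format, OF this, of i j]
    show ?thesis using \<open>i < j\<close> by (cases "j = i") auto
  qed
  then show "attractive p"
    by (auto simp: attractive_def stoch_le_def mono_def[of "\<lambda>\<eta>. \<integral>\<sigma>. _ \<sigma> \<partial>kernel p \<eta>"])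
qed

theorem proposition5p2:
  assumes "class_Z TYPE('s::{finite,order})"
    and "CARD('n::{finite,linorder}) \<ge> 2"
  shows "(\<forall>P :: 'n \<Rightarrow> ('d::finite, 's) rule. (\<forall>i. PCA (P i)) \<longrightarrow>
            ((\<exists>Q. increasing_synchronous_coupling P Q) \<longleftrightarrow> increasing_tuple P)) \<and>
         (\<forall>P :: ('d, 's) rule. PCA P \<longrightarrow>
            ((\<exists>Q. increasing_synchronous_coupling (\<lambda>_::'n. P) Q) \<longleftrightarrow> attractive P))"
proof -
  have *: "(\<exists>Q. increasing_synchronous_coupling P Q) \<longleftrightarrow> increasing_tuple P"
    if "\<forall>i. PCA (P i)" for P :: "'n \<Rightarrow> ('d, 's) rule"
    using that increasing_tuple_of_coupling coupling_of_increasing_tuple by blast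
  \<comment> \<open>The attractive case is the constant tuple.\<close>
  then show ?thesis
    by (simp add: increasing_tuple_const_iff[OF assms(2)])
qed

end
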